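(* Let $\Phi=(A;\{E_i\}_{i=0}^d;A^*;\{E_i^*\}_{i=0}^d)$ be a tridiagonal system of diameter $d\geq 1$ on $V$ over $\mathbb{K}$, and let $\Delta\in\mathrm{End}(V)$ be the linear transformation attached to $\Phi$ as defined in the context. Then for $0\le i\le d$ both $$(\Delta-I)E_i^*V\subseteq E_0^*V+E_1^*V+\cdots+E_{i-1}^*V,$$ $$\Delta(E_iV+E_{i+1}V+\cdots+E_dV)=E_0V+E_1V+\cdots+E_{d-i}V.$$
   Context: $\mathbb{K}$ is a field, $V$ is a $\mathbb{K}$-vector space of finite positive dimension, $\mathrm{End}(V)$ is the algebra of linear maps $V\to V$, and $I$ is the identity. A tridiagonal pair (TD pair) on $V$ is an ordered pair $A,A^*\in\mathrm{End}(V)$ ($A^*$ is just a name, not an adjoint) such that: (i) $A$ and $A^*$ are each diagonalizable over $\mathbb{K}$; (ii) there is an ordering $\{V_i\}_{i=0}^d$ of the eigenspaces of $A$ with $A^*V_i\subseteq V_{i-1}+V_i+V_{i+1}$ for $0\le i\le d$, where $V_{-1}=V_{d+1}=0$; (iii) there is an ordering $\{V_i^*\}_{i=0}^{\delta}$ of the eigenspaces of $A^*$ with $AV_i^*\subseteq V_{i-1}^*+V_i^*+V_{i+1}^*$ for $0\le i\le\delta$, where $V_{-1}^*=V_{\delta+1}^*=0$; (iv) there is no subspace $W$ of $V$ with $AW\subseteq W$, $A^*W\subseteq W$, $W\ne0$, $W\ne V$. It is known that $d=\delta$; this is the diameter, and it is assumed that $d\ge1$. Orderings satisfying (ii) (resp.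 (iii)) are called standard. The primitive idempotent of a diagonalizable map associated with one of its eigenspaces is the projection of $V$ onto that eigenspace that kills the other eigenspaces. A tridiagonal system (TD system) on $V$ is a sequence $\Phi=(A;\{E_i\}_{i=0}^d;A^*;\{E_i^*\}_{i=0}^d)$ where $A,A^*$ is a TD pair on $V$, $\{E_i\}_{i=0}^d$ is an ordering of the primitive idempotents of $A$ such that $\{E_iV\}_{i=0}^d$ is standard, and $\{E_i^*\}_{i=0}^d$ is an ordering of the primitive idempotents of $A^*$ such that $\{E_i^*V\}_{i=0}^d$ is standard. For $0\le i\le d$ set $U_i=(E_0^*V+\cdots+E_i^*V)\cap(E_iV+\cdots+E_dV)$ and $U_i^{\Downarrow}=(E_0^*V+\cdots+E_i^*V)\cap(E_0V+\cdots+E_{d-i}V)$. It is known that $V=\bigoplus_{i=0}^dU_i=\bigoplus_{i=0}^dU_i^{\Downarrow}$ (first and second split decompositions). Let $F_i$ be the projection of $V$ onto $U_i$ along $\bigoplus_{j\ne i}U_j$, and $F_i^{\Downarrow}$ the projection of $V$ onto $U_i^{\Downarrow}$ along $\bigoplus_{j\ne i}U_j^{\Downarrow}$. Define $\Delta=\sum_{h=0}^dF_h^{\Downarrow}F_h$. An empty sum of subspaces is $0$. *)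

theory Defs
  imports HOL.Vector_Spaces "HOL-Library.Set_Algebras"
begin

text \<open>
  The vector space \<open>V\<close> is the whole type \<open>'b\<close>, with scalar multiplication \<open>scale\<close>.
  Sums of subspaces are the elementwise sums of \<open>Set_Algebras\<close>; in particular the empty sum
  is \<open>0 = {0}\<close>. Families indexed by \<open>0, \<dots>, d\<close> are functions on \<open>nat\<close> whose values beyond \<open>d\<close>
  are never used.
\<close>

context vector_space
begin

definition eigenspaces :: "('b \<Rightarrow> 'b) \<Rightarrow> 'b set set" where
  "eigenspaces A = {X. X \<noteq> {0} \<and> (\<exists>\<theta>. X = {v. A v = scale \<theta> v})}"

definition diagonalizable :: "('b \<Rightarrow> 'b) \<Rightarrow> bool" where
  "diagonalizable A \<longleftrightarrow>
     (\<exists>B. independent B \<and> span B = UNIV \<and> (\<forall>b\<in>B. \<exists>\<theta>. A b = scale \<theta> b))"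

definition standard_ordering :: "nat \<Rightarrow> ('b \<Rightarrow> 'b) \<Rightarrow> ('b \<Rightarrow> 'b) \<Rightarrow> (nat \<Rightarrow> 'b set) \<Rightarrow> bool" where
  "standard_ordering d A A' W \<longleftrightarrow>
     bij_betw W {0..d} (eigenspaces A) \<and>
     (\<forall>i\<le>d. A' ` W i \<subseteq> (if i = 0 then {0} else W (i - 1)) + W i + (if i = d then {0} else W (i + 1)))"

definition td_pair :: "('b \<Rightarrow> 'b) \<Rightarrow> ('b \<Rightarrow> 'b) \<Rightarrow> bool" where
  "td_pair A A' \<longleftrightarrow>
     Vector_Spaces.linear scale scale A \<and> Vector_Spaces.linear scale scale A' \<and>
     diagonalizable A \<and> diagonalizable A' \<and>
     (\<exists>d W. standard_ordering d A A' W) \<and>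
     (\<exists>\<delta> W'. standard_ordering \<delta> A' A W') \<and>
     \<not> (\<exists>W. subspace W \<and> A ` W \<subseteq> W \<and> A' ` W \<subseteq> W \<and> W \<noteq> {0} \<and> W \<noteq> UNIV)"

definition primitive_idempotents :: "('b \<Rightarrow> 'b) \<Rightarrow> ('b \<Rightarrow> 'b) set" where
  "primitive_idempotents A =
     {P. Vector_Spaces.linear scale scale P \<and>
         (\<exists>X\<in>eigenspaces A. range P = X \<and> (\<forall>v\<in>X. P v = v) \<and>
            (\<forall>Y\<in>eigenspaces A. Y \<noteq> X \<longrightarrow> (\<forall>v\<in>Y. P v = 0)))}"

definition td_system ::
    "nat \<Rightarrow> ('b \<Rightarrow> 'b) \<Rightarrow> (nat \<Rightarrow> 'b \<Rightarrow> 'b) \<Rightarrow> ('b \<Rightarrow> 'b) \<Rightarrow> (nat \<Rightarrow> 'b \<Rightarrow> 'b) \<Rightarrow> bool" where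
  "td_system d A E A' E' \<longleftrightarrow>
     td_pair A A' \<and>
     bij_betw E {0..d} (primitive_idempotents A) \<and>
     standard_ordering d A A' (\<lambda>i. range (E i)) \<and>
     bij_betw E' {0..d} (primitive_idempotents A') \<and>
     standard_ordering d A' A (\<lambda>i. range (E' i))"

end

text \<open>Meaningful only if the ambient space is the direct sum of \<open>X\<close> and \<open>Y\<close>.\<close>

definition projection_along :: "'v::ab_group_add set \<Rightarrow> 'v set \<Rightarrow> 'v \<Rightarrow> 'v" where
  "projection_along X Y v = (THE x. x \<in> X \<and> v - x \<in> Y)"

definition split_U ::
    "nat \<Rightarrow> (nat \<Rightarrow> 'v \<Rightarrow> 'v::ab_group_add) \<Rightarrow> (nat \<Rightarrow> 'v \<Rightarrow> 'v) \<Rightarrow> nat \<Rightarrow> 'v set" where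
  "split_U d E E' i = (\<Sum>j=0..i. range (E' j)) \<inter> (\<Sum>j=i..d. range (E j))"

definition split_U_Down ::
    "nat \<Rightarrow> (nat \<Rightarrow> 'v \<Rightarrow> 'v::ab_group_add) \<Rightarrow> (nat \<Rightarrow> 'v \<Rightarrow> 'v) \<Rightarrow> nat \<Rightarrow> 'v set" where
  "split_U_Down d E E' i = (\<Sum>j=0..i. range (E' j)) \<inter> (\<Sum>j=0..d - i. range (E j))"

definition split_F ::
    "nat \<Rightarrow> (nat \<Rightarrow> 'v \<Rightarrow> 'v::ab_group_add) \<Rightarrow> (nat \<Rightarrow> 'v \<Rightarrow> 'v) \<Rightarrow> nat \<Rightarrow> 'v \<Rightarrow> 'v" where
  "split_F d E E' i =
     projection_along (split_U d E E' i) (\<Sum>j\<in>{0..d} - {i}. split_U d E E' j)"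

definition split_F_Down ::
    "nat \<Rightarrow> (nat \<Rightarrow> 'v \<Rightarrow> 'v::ab_group_add) \<Rightarrow> (nat \<Rightarrow> 'v \<Rightarrow> 'v) \<Rightarrow> nat \<Rightarrow> 'v \<Rightarrow> 'v" where
  "split_F_Down d E E' i =
     projection_along (split_U_Down d E E' i) (\<Sum>j\<in>{0..d} - {i}. split_U_Down d E E' j)"

definition td_Delta ::
    "nat \<Rightarrow> (nat \<Rightarrow> 'v \<Rightarrow> 'v::ab_group_add) \<Rightarrow> (nat \<Rightarrow> 'v \<Rightarrow> 'v) \<Rightarrow> 'v \<Rightarrow> 'v" where
  "td_Delta d E E' v = (\<Sum>h=0..d. split_F_Down d E E' h (split_F d E E' h v))"

end

theory Submission
  imports Defs
begin

text \<open>
  Write \<open>X\<^sub>i = E\<^sub>0\<^sup>*V + \<dots> + E\<^sub>i\<^sub>-\<^sub>1\<^sup>*V\<close>, \<open>Q\<^sub>i = E\<^sub>iV + \<dots> + E\<^sub>dV\<close> and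
  \<open>Q'\<^sub>i = E\<^sub>0V + \<dots> + E\<^sub>d\<^sub>-\<^sub>iV\<close>, so that both split decompositions refine the same increasing flag
  \<open>X\<close>: their pieces are \<open>X\<^sub>i\<^sub>+\<^sub>1 \<inter> Q\<^sub>i\<close> and \<open>X\<^sub>i\<^sub>+\<^sub>1 \<inter> Q'\<^sub>i\<close>.

  Irreducibility makes these decompositions exist. On a flag of sums of eigenspaces, one of the two
  maps minus a suitable scalar lowers the index by one, while the other map raises it by at most one.
  For the two opposite flags these shifts compensate, so every sum
  \<open>\<Sum>\<^sub>k X\<^sub>k\<^sub>+\<^sub>1 \<inter> Q\<^sub>k\<^sub>+\<^sub>r\<close> is invariant under both maps (lemma \<open>diagonal_sum_invariant\<close>). For
  \<open>r = 0\<close> it contains \<open>X\<^sub>1 \<noteq> 0\<close> and hence is \<open>V\<close>, so the pieces span \<open>V\<close>; for \<open>r = 1\<close> it lies in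
  \<open>Q\<^sub>1 \<noteq> V\<close> and hence is \<open>0\<close>, so \<open>X\<^sub>i \<inter> Q\<^sub>i = 0\<close>. These two facts
  (lemma \<open>split_flags_of_irreducible\<close>) give directness of the sum, and they give that \<open>X\<^sub>i\<close> is the
  sum of the pieces of index below \<open>i\<close> and \<open>Q\<^sub>i\<close> the sum of the others. Reversing the order of the
  eigenspaces of \<open>A\<close> gives the same for \<open>Q'\<close>.

  The rest uses only two splittings that share the flag \<open>X\<close>. A vector of the \<open>h\<close>th piece of the first
  splitting lies in \<open>X\<^sub>h\<^sub>+\<^sub>1\<close>, so its \<open>h\<close>th component in the second splitting agrees with it modulo
  \<open>X\<^sub>h\<close>. Thus \<open>\<Delta>\<close> acts as the identity on each quotient \<open>X\<^sub>i\<^sub>+\<^sub>1/X\<^sub>i\<close>; this is the first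
  claim, and it makes \<open>\<Delta>\<close> surjective. As \<open>\<Delta>\<close> carries each piece of the first splitting into the
  corresponding piece of the second, it maps \<open>Q\<^sub>i\<close> into \<open>Q'\<^sub>i\<close>. Finally, if \<open>\<Delta> v \<in> Q'\<^sub>i\<close>
  and \<open>v = a + b\<close> with \<open>a \<in> X\<^sub>i\<close>, \<open>b \<in> Q\<^sub>i\<close>, then \<open>\<Delta> a \<in> X\<^sub>i \<inter> Q'\<^sub>i = 0\<close>, so
  \<open>\<Delta> v = \<Delta> b\<close>; this gives equality in the second claim (lemma \<open>Delta_image_Q\<close>).
\<close>

section \<open>Elementwise sums of subspaces\<close>

lemma mem_set_sum_iff:
  fixes S :: "'i \<Rightarrow> 'a::comm_monoid_add set"
  assumes "finite I"
  shows "v \<in> (\<Sum>i\<in>I. S i) \<longleftrightarrow> (\<exists>f. (\<forall>i\<in>I. f i \<in> S i) \<and> v = (\<Sum>i\<in>I. f i))"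
  unfolding set_sum_alt[OF assms] by auto

context vector_space
begin

lemma subspace_set_sum:
  assumes "finite I" "\<And>i. i \<in> I \<Longrightarrow> subspace (S i)"
  shows "subspace (\<Sum>i\<in>I. S i)"
  using assms
proof (induction I rule: finite_induct)
  case empty
  then show ?case by (simp add: set_zero subspace_0 subspace_def)
next
  case (insert x F)
  have "S x + (\<Sum>i\<in>F. S i) = {a + b |a b. a \<in> S x \<and> b \<in> (\<Sum>i\<in>F. S i)}"
    by (auto simp: set_plus_def)
  then show ?case
    using insert subspace_sums[of "S x" "\<Sum>i\<in>F. S i"] by simp
qed

lemma set_sum_upper:
  assumes "finite I" "\<And>i. i \<in> I \<Longrightarrow> subspace (S i)" "i \<in> I"
  shows "S i \<subseteq> (\<Sum>i\<in>I. S i)"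
proof
  fix v assume v: "v \<in> S i"
  show "v \<in> (\<Sum>i\<in>I. S i)"
    unfolding mem_set_sum_iff[OF assms(1)]
    by (rule exI[of _ "\<lambda>j. if j = i then v else 0"])
      (use assms v subspace_0 in auto)
qed

lemma set_sum_least:
  assumes "finite I" "subspace T" "\<And>i. i \<in> I \<Longrightarrow> S i \<subseteq> T"
  shows "(\<Sum>i\<in>I. S i) \<subseteq> T"
proof
  fix v assume "v \<in> (\<Sum>i\<in>I. S i)"
  then obtain f where f: "\<forall>i\<in>I. f i \<in> S i" "v = (\<Sum>i\<in>I. f i)"
    using assms(1) by (auto simp: mem_set_sum_iff)
  then have "f i \<in> T" if "i \<in> I" for i using assms(3) that by blast
  then show "v \<in> T" unfolding f(2) by (rule subspace_sum[OF assms(2)])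
qed

lemma set_sum_mono2:
  assumes "finite J" "I \<subseteq> J" "\<And>i. i \<in> J \<Longrightarrow> subspace (S i)"
  shows "(\<Sum>i\<in>I. S i) \<subseteq> (\<Sum>i\<in>J. S i)"
  using assms set_sum_upper[of J S] finite_subset[OF assms(2,1)]
  by (intro set_sum_least subspace_set_sum) auto

end

section \<open>The splitting of a space by two opposite flags\<close>

text \<open>
  The indices are shifted so that \<open>X i\<close> complements \<open>Q i\<close>: the last two conditions give
  \<open>V = X i \<oplus> Q i\<close>, and the successive overlaps \<open>X (Suc i) \<inter> Q i\<close> are the pieces of the splitting.
\<close>

locale split_flags = vector_space scale
  for scale :: "'k::field \<Rightarrow> 'v::ab_group_add \<Rightarrow> 'v" +
  fixes d :: nat and X Q :: "nat \<Rightarrow> 'v set"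
  assumes subX: "subspace (X i)" and subQ: "subspace (Q i)"
    and monoX: "i \<le> j \<Longrightarrow> X i \<subseteq> X j"
    and antimonoQ: "i \<le> j \<Longrightarrow> Q j \<subseteq> Q i"
    and X_0: "X 0 = {0}" and X_top: "X (Suc d) = UNIV"
    and transversal: "i \<le> Suc d \<Longrightarrow> X i \<inter> Q i = {0}"
    and pieces_span: "(\<Sum>i=0..d. X (Suc i) \<inter> Q i) = UNIV"
begin

definition U :: "nat \<Rightarrow> 'v set" where "U i = X (Suc i) \<inter> Q i"

definition F :: "nat \<Rightarrow> 'v \<Rightarrow> 'v" where
  "F i = projection_along (U i) (\<Sum>j\<in>{0..d} - {i}. U j)"

lemma subU: "subspace (U i)"
  unfolding U_def by (intro subspace_inter subX subQ)

lemma head_in_X: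
  assumes "\<And>j. j < i \<Longrightarrow> u j \<in> U j" shows "(\<Sum>j<i. u j) \<in> X i"
  using assms monoX[of "Suc _" i]
  by (intro subspace_sum subX) (force simp: U_def)

lemma tail_in_Q:
  assumes "\<And>j. j \<le> d \<Longrightarrow> u j \<in> U j" shows "(\<Sum>j=i..d. u j) \<in> Q i"
  using assms antimonoQ[of i]
  by (intro subspace_sum subQ) (force simp: U_def)

lemma sum_split_at:
  assumes "i \<le> Suc d"
  shows "(\<Sum>j=0..d. u j) = (\<Sum>j<i. u j) + (\<Sum>j=i..d. (u j :: 'v))"
proof -
  have "{0..d} = {..<i} \<union> {i..d}" using assms by auto
  then show ?thesis by (simp only:) (rule sum.union_disjoint; auto)
qed

text \<open>
  Cut a sum of components at \<open>i\<close>: the head is in \<open>X i\<close> and the tail in \<open>Q i\<close>. If the whole sum lies in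
  one of the two spaces, then the part from the other lies in both, so it vanishes by transversality.
  Applied at two consecutive cuts, this isolates single components.
\<close>

lemma head_tail_0:
  assumes u: "\<And>j. j \<le> d \<Longrightarrow> u j \<in> U j" and i: "i \<le> Suc d"
  shows "(\<Sum>j=0..d. u j) \<in> X i \<Longrightarrow> (\<Sum>j=i..d. u j) = 0"
    and "(\<Sum>j=0..d. u j) \<in> Q i \<Longrightarrow> (\<Sum>j<i. u j) = 0"
proof -
  have h: "(\<Sum>j<i. u j) \<in> X i" using u i by (intro head_in_X) auto
  have t: "(\<Sum>j=i..d. u j) \<in> Q i" using u by (rule tail_in_Q)
  show "(\<Sum>j=i..d. u j) = 0" if "(\<Sum>j=0..d. u j) \<in> X i"
    using subspace_diff[OF subX that h] t transversal[OF i] sum_split_at[OF i, of u] by auto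
  show "(\<Sum>j<i. u j) = 0" if "(\<Sum>j=0..d. u j) \<in> Q i"
    using subspace_diff[OF subQ that t] h transversal[OF i] sum_split_at[OF i, of u] by auto
qed

lemma component_0_if_in_X:
  assumes u: "\<And>j. j \<le> d \<Longrightarrow> u j \<in> U j" and v: "(\<Sum>j=0..d. u j) \<in> X i"
    and "i \<le> j" "j \<le> d"
  shows "u j = 0"
proof -
  have "(\<Sum>k=j..d. u k) = 0" "(\<Sum>k=Suc j..d. u k) = 0"
    using assms monoX[of i j] monoX[of i "Suc j"] by (intro head_tail_0; auto)+
  then show ?thesis using \<open>j \<le> d\<close> by (simp add: sum.atLeast_Suc_atMost)
qed

lemma component_0_if_in_Q:
  assumes u: "\<And>j. j \<le> d \<Longrightarrow> u j \<in> U j" and v: "(\<Sum>j=0..d. u j) \<in> Q i"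
    and "j < i" "j \<le> d"
  shows "u j = 0"
proof -
  have "(\<Sum>k<j. u k) = 0" "(\<Sum>k<Suc j. u k) = 0"
    using assms antimonoQ[of j i] antimonoQ[of "Suc j" i] by (intro head_tail_0; auto)+
  then show ?thesis by simp
qed

text \<open>
  The definite description behind \<open>F i\<close> is resolved here: the difference of two decompositions of the
  same vector is a decomposition of \<open>0 \<in> X 0\<close>, so all its components vanish.
\<close>

lemma F_sum:
  assumes u: "\<And>j. j \<le> d \<Longrightarrow> u j \<in> U j" and i: "i \<le> d"
  shows "F i (\<Sum>j=0..d. u j) = u i"
  unfolding F_def projection_along_def
proof (rule the_equality)
  let ?R = "\<Sum>j\<in>{0..d} - {i}. U j"
  have "(\<Sum>j=0..d. u j) - u i = (\<Sum>j\<in>{0..d} - {i}. u j)"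
    using i by (subst sum.remove[of _ i]) auto
  then show "u i \<in> U i \<and> (\<Sum>j=0..d. u j) - u i \<in> ?R"
    using u i by (auto simp: mem_set_sum_iff intro!: exI[of _ u])
next
  fix x assume x: "x \<in> U i \<and> (\<Sum>j=0..d. u j) - x \<in> (\<Sum>j\<in>{0..d} - {i}. U j)"
  then obtain f where f: "\<forall>j\<in>{0..d} - {i}. f j \<in> U j"
    and eq: "(\<Sum>j=0..d. u j) - x = (\<Sum>j\<in>{0..d} - {i}. f j)"
    by (auto simp: mem_set_sum_iff)
  \<comment> \<open>the decomposition that has \<open>x\<close> as its component of index \<open>i\<close>\<close>
  let ?g = "f(i := x)"
  have "(\<Sum>j=0..d. ?g j) = x + (\<Sum>j\<in>{0..d} - {i}. ?g j)"
    using i by (subst sum.remove[of _ i]) auto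
  also have "(\<Sum>j\<in>{0..d} - {i}. ?g j) = (\<Sum>j\<in>{0..d} - {i}. f j)"
    by (rule sum.cong) auto
  finally have "(\<Sum>j=0..d. u j - ?g j) = 0"
    unfolding sum_subtractf using eq by (simp add: algebra_simps)
  moreover have "u j - ?g j \<in> U j" if "j \<le> d" for j
    using f x u[OF that] that by (intro subspace_diff subU) auto
  ultimately have "u i - ?g i = 0"
    using X_0 i by (intro component_0_if_in_X[of "\<lambda>j. u j - ?g j" 0]) auto
  then show "x = u i" by simp
qed

lemma decomposition:
  shows F_in_U: "i \<le> d \<Longrightarrow> F i v \<in> U i" and sum_F: "(\<Sum>j=0..d. F j v) = v"
proof -
  obtain u where u: "\<forall>j\<in>{0..d}. u j \<in> U j" "v = (\<Sum>j=0..d. u j)"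
    using pieces_span mem_set_sum_iff[of "{0..d}" v U] unfolding U_def by auto
  then have F: "F i v = u i" if "i \<le> d" for i
    using F_sum[of u i] that by auto
  show "F i v \<in> U i" if "i \<le> d" using F[OF that] u that by auto
  show "(\<Sum>j=0..d. F j v) = v"
    using F u by (auto intro: sum.cong)
qed

lemma F_0_if_in_X: "v \<in> X i \<Longrightarrow> i \<le> j \<Longrightarrow> j \<le> d \<Longrightarrow> F j v = 0"
  using component_0_if_in_X[of "\<lambda>j. F j v" i j] F_in_U sum_F by auto

lemma F_0_if_in_Q: "v \<in> Q i \<Longrightarrow> j < i \<Longrightarrow> j \<le> d \<Longrightarrow> F j v = 0"
  using component_0_if_in_Q[of "\<lambda>j. F j v" i j] F_in_U sum_F by auto

lemma F_add: "i \<le> d \<Longrightarrow> F i (v + w) = F i v + F i w"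
  using F_sum[of "\<lambda>j. F j v + F j w" i] F_in_U subU
  by (simp add: sum.distrib sum_F subspace_add)

lemma F_of_0: "i \<le> d \<Longrightarrow> F i 0 = 0"
  using F_add[of i 0 0] by simp

text \<open>
  Only the components of index at most \<open>h\<close> of such a \<open>v\<close> survive, so \<open>F h v\<close> is \<open>v\<close> up to
  components of smaller index.
\<close>

lemma F_leading_term:
  assumes v: "v \<in> X (Suc h)" and h: "h \<le> d"
  shows "F h v - v \<in> X h"
proof -
  have "(\<Sum>j=Suc h..d. F j v) = 0"
    using F_0_if_in_X[OF v] by (auto intro: sum.neutral)
  then have "v = (\<Sum>j<Suc h. F j v)"
    using sum_split_at[of "Suc h" "\<lambda>j. F j v"] sum_F[of v] h by simp
  then have "F h v - v = - (\<Sum>j<h. F j v)"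
    by (simp add: algebra_simps)
  moreover have "(\<Sum>j<h. F j v) \<in> X h"
    using F_in_U h by (intro head_in_X) auto
  ultimately show ?thesis using subspace_neg[OF subX] by metis
qed

end

section \<open>The map comparing two splittings with a common flag\<close>

locale two_split_flags = up: split_flags scale d X Q + down: split_flags scale d X Q'
  for scale :: "'k::field \<Rightarrow> 'v::ab_group_add \<Rightarrow> 'v" and d X Q Q'
begin

definition \<Delta> :: "'v \<Rightarrow> 'v" where
  "\<Delta> v = (\<Sum>h=0..d. down.F h (up.F h v))"

lemma Delta_add: "\<Delta> (v + w) = \<Delta> v + \<Delta> w"
  unfolding \<Delta>_def sum.distrib[symmetric]
  by (rule sum.cong) (auto simp: up.F_add down.F_add)

lemma Delta_diff: "\<Delta> (v - w) = \<Delta> v - \<Delta> w"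
  using Delta_add[of "v - w" w] by simp

text \<open>
  As the components of \<open>v\<close> add up to \<open>v\<close>, the difference is a sum of terms \<open>F\<^sup>\<Down> x - x\<close>, where \<open>x\<close> runs
  through the components of the first splitting; each of them is controlled by the leading term property
  of the second splitting.
\<close>

lemma Delta_unipotent:
  assumes v: "v \<in> X (Suc i)"
  shows "\<Delta> v - v \<in> X i"
proof -
  have "\<Delta> v - v = (\<Sum>h=0..d. down.F h (up.F h v) - up.F h v)"
    by (simp add: \<Delta>_def sum_subtractf up.sum_F)
  also have "\<dots> \<in> X i"
  proof (rule up.subspace_sum[OF up.subX])
    fix h assume "h \<in> {0..d}"
    then have h: "h \<le> d" by simp
    show "down.F h (up.F h v) - up.F h v \<in> X i"
    proof (cases "h \<le> i")
      case True
      have "down.F h (up.F h v) - up.F h v \<in> X h"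
        using down.F_leading_term[OF _ h] up.F_in_U[OF h] by (auto simp: up.U_def)
      then show ?thesis using up.monoX[OF True] by auto
    next
      case False
      then have "up.F h v = 0" using up.F_0_if_in_X[OF v _ h] by simp
      then show ?thesis using down.F_of_0[OF h] up.subspace_0[OF up.subX] by simp
    qed
  qed
  finally show ?thesis .
qed

text \<open>
  Solve \<open>\<Delta> u = v\<close> by successive approximation: \<open>u = v\<close> is right up to an error one step further down the
  flag, which the induction hypothesis corrects. Surjectivity of \<open>\<Delta>\<close> is the case of the whole space.
\<close>

lemma Delta_onto_X: "X n \<subseteq> \<Delta> ` X n"
proof (induction n)
  case 0
  have "\<Delta> 0 = 0" using Delta_diff[of 0 0] by simp
  then show ?case using up.X_0 by force
next
  case (Suc n)
  show ?case
  proof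
    fix v assume v: "v \<in> X (Suc n)"
    then obtain w where w: "w \<in> X n" "\<Delta> v - v = \<Delta> w"
      using Delta_unipotent[OF v] Suc.IH by auto
    then have "v = \<Delta> (v - w)" by (simp add: Delta_diff algebra_simps)
    moreover have "v - w \<in> X (Suc n)"
      using v w up.monoX[of n "Suc n"] by (intro up.subspace_diff[OF up.subX]) auto
    ultimately show "v \<in> \<Delta> ` X (Suc n)" by blast
  qed
qed

lemma Delta_preserves_X:
  assumes "v \<in> X i" shows "\<Delta> v \<in> X i"
proof (cases i)
  case 0
  then show ?thesis using assms up.X_0 Delta_diff[of 0 0] by auto
next
  case (Suc n)
  have "\<Delta> v - v \<in> X (Suc n)"
    using Delta_unipotent[of v n] assms Suc up.monoX[of n "Suc n"] by auto
  then show ?thesis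
    using assms Suc up.subspace_add[OF up.subX, of "\<Delta> v - v" "Suc n" v] by simp
qed

lemma Delta_maps_Q:
  assumes v: "v \<in> Q i" and i: "i \<le> Suc d"
  shows "\<Delta> v \<in> Q' i"
proof -
  have "(\<Sum>h<i. down.F h (up.F h v)) = 0"
    using up.F_0_if_in_Q[OF v] down.F_of_0 i by (intro sum.neutral) auto
  then have "\<Delta> v = (\<Sum>h=i..d. down.F h (up.F h v))"
    unfolding \<Delta>_def using down.sum_split_at[OF i, of "\<lambda>h. down.F h (up.F h v)"] by simp
  then show ?thesis using down.tail_in_Q[of "\<lambda>h. down.F h (up.F h v)"] down.F_in_U by simp
qed

text \<open>
  A preimage in \<open>Q i\<close> is obtained from any preimage by discarding its part in \<open>X i\<close>: \<open>\<Delta>\<close> keeps that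
  part in \<open>X i\<close>, but its image is also a difference of elements of \<open>Q' i\<close>, hence \<open>0\<close>.
\<close>

lemma Delta_image_Q:
  assumes i: "i \<le> Suc d"
  shows "\<Delta> ` Q i = Q' i"
proof
  show "\<Delta> ` Q i \<subseteq> Q' i" using Delta_maps_Q i by auto
  show "Q' i \<subseteq> \<Delta> ` Q i"
  proof
    fix w assume w: "w \<in> Q' i"
    obtain v where v: "w = \<Delta> v" using Delta_onto_X[of "Suc d"] up.X_top by auto
    define a where "a = (\<Sum>j<i. up.F j v)"
    define b where "b = (\<Sum>j=i..d. up.F j v)"
    have ab: "v = a + b"
      using up.sum_split_at[OF i, of "\<lambda>j. up.F j v"] up.sum_F[of v] by (simp add: a_def b_def)
    have a: "a \<in> X i" unfolding a_def using up.F_in_U i by (intro up.head_in_X) auto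
    have b: "b \<in> Q i" unfolding b_def by (intro up.tail_in_Q up.F_in_U)
    have "\<Delta> a = w - \<Delta> b" using ab v by (simp add: Delta_add)
    then have "\<Delta> a \<in> Q' i"
      using w Delta_maps_Q[OF b i] by (simp add: up.subspace_diff[OF down.subQ])
    then have "\<Delta> a = 0" using Delta_preserves_X[OF a] down.transversal[OF i] by auto
    then have "w = \<Delta> b" using ab v by (simp add: Delta_add)
    then show "w \<in> \<Delta> ` Q i" using b by blast
  qed
qed

end

section \<open>Flags of eigenspaces\<close>

context vector_space
begin

text \<open>
  The tridiagonal condition is symmetric under reversal. Consequently the second split decomposition is
  the first one for the reversed ordering of the eigenspaces of \<open>A\<close>.
\<close>

lemma standard_ordering_reverse:
  assumes "standard_ordering d A A' W"
  shows "standard_ordering d A A' (\<lambda>i. W (d - i))"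
  unfolding standard_ordering_def
proof (intro conjI allI impI)
  have "bij_betw (\<lambda>i. d - i) {0..d} {0..d}"
    by (rule bij_betw_byWitness[of _ "\<lambda>i. d - i"]) auto
  then show "bij_betw (\<lambda>i. W (d - i)) {0..d} (eigenspaces A)"
    using assms bij_betw_trans[of "\<lambda>i. d - i" "{0..d}" "{0..d}" W "eigenspaces A"]
    by (simp add: standard_ordering_def comp_def)
next
  fix i assume i: "i \<le> d"
  have *: "A' ` W (d - i) \<subseteq> (if d - i = 0 then {0} else W (d - i - 1)) + W (d - i)
      + (if d - i = d then {0} else W (d - i + 1))"
    using assms diff_le_self[of d i] unfolding standard_ordering_def by blast
  have "(if d - i = 0 then {0} else W (d - i - 1)) = (if i = d then {0} else W (d - (i + 1)))"
    "(if d - i = d then {0} else W (d - i + 1)) = (if i = 0 then {0} else W (d - (i - 1)))"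
    using i by (auto simp: Suc_diff_le)
  then show "A' ` W (d - i) \<subseteq> (if i = 0 then {0} else W (d - (i - 1))) + W (d - i)
      + (if i = d then {0} else W (d - (i + 1)))"
    using * by (simp only: ac_simps)
qed

lemma standard_ordering_eigenspace:
  assumes "standard_ordering d A A' W" "i \<le> d"
  obtains \<theta> where "W i = {v. A v = scale \<theta> v}" "W i \<noteq> {0}"
proof -
  have "W i \<in> eigenspaces A"
    using assms by (auto simp: standard_ordering_def bij_betw_def)
  then show ?thesis using that by (auto simp: eigenspaces_def)
qed

lemma subspace_eigenspace:
  assumes "Vector_Spaces.linear scale scale A"
  shows "subspace {v. A v = scale \<theta> v}"
proof -
  interpret A: Vector_Spaces.linear scale scale A by fact
  show ?thesis
    by (auto simp: subspace_def A.add A.scale A.zero scale_right_distrib mult.commute)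
qed

definition flag :: "(nat \<Rightarrow> 'b set) \<Rightarrow> nat \<Rightarrow> 'b set" where
  "flag W n = (\<Sum>j<n. W j)"

text \<open>
  What a standard ordering means for partial sums of eigenspaces, stripped of the eigenspaces themselves:
  \<open>A\<close> preserves every step of the flag, acting as a scalar on successive quotients, and \<open>A'\<close> moves up by at
  most one step.
\<close>

definition eigenflag :: "nat \<Rightarrow> ('b \<Rightarrow> 'b) \<Rightarrow> ('b \<Rightarrow> 'b) \<Rightarrow> (nat \<Rightarrow> 'b set) \<Rightarrow> bool" where
  "eigenflag d A A' G \<longleftrightarrow>
     (\<forall>n\<le>Suc d. subspace (G n)) \<and>
     (\<forall>m n. m \<le> n \<longrightarrow> n \<le> Suc d \<longrightarrow> G m \<subseteq> G n) \<and>
     G 0 = {0} \<and> G (Suc 0) \<noteq> {0} \<and> G (Suc d) = UNIV \<and>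
     (\<forall>n\<le>d. \<exists>\<theta>. \<forall>v\<in>G (Suc n). A v - scale \<theta> v \<in> G n) \<and>
     (\<forall>n\<le>d. \<forall>v\<in>G n. A' v \<in> G (Suc n))"

lemma eigenflagD:
  assumes "eigenflag d A A' G"
  shows eigenflag_subspace: "n \<le> Suc d \<Longrightarrow> subspace (G n)"
    and eigenflag_mono: "m \<le> n \<Longrightarrow> n \<le> Suc d \<Longrightarrow> G m \<subseteq> G n"
    and eigenflag_0: "G 0 = {0}" and eigenflag_1: "G (Suc 0) \<noteq> {0}"
    and eigenflag_top: "G (Suc d) = UNIV"
    and eigenflag_lower: "n \<le> d \<Longrightarrow> \<exists>\<theta>. \<forall>v\<in>G (Suc n). A v - scale \<theta> v \<in> G n"
    and eigenflag_raise: "n \<le> d \<Longrightarrow> v \<in> G n \<Longrightarrow> A' v \<in> G (Suc n)"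
  using assms unfolding eigenflag_def by blast+

text \<open>
  The scalar by which \<open>A\<close> lowers \<open>flag W (Suc n)\<close> is the eigenvalue of \<open>W n\<close>: subtracting it kills
  \<open>W n\<close> and preserves the other eigenspaces. That the flag is exhaustive is diagonalizability.
\<close>

lemma eigenflag_of_standard_ordering:
  assumes linA: "Vector_Spaces.linear scale scale A"
    and linA': "Vector_Spaces.linear scale scale A'"
    and diag: "diagonalizable A"
    and std: "standard_ordering d A A' W"
  shows "eigenflag d A A' (flag W)"
proof -
  interpret A: Vector_Spaces.linear scale scale A by fact
  interpret A': Vector_Spaces.linear scale scale A' by fact
  have subW: "subspace (W i)" if "i \<le> d" for i
    using standard_ordering_eigenspace[OF std that] subspace_eigenspace[OF linA] by metis
  have subG: "subspace (flag W n)" if "n \<le> Suc d" for n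
    unfolding flag_def using that subW by (intro subspace_set_sum) auto
  have W_le: "W i \<subseteq> flag W n" if "i < n" "n \<le> Suc d" for i n
    unfolding flag_def using that subW by (intro set_sum_upper) auto
  have mono: "flag W m \<subseteq> flag W n" if "m \<le> n" "n \<le> Suc d" for m n
    unfolding flag_def using that subW by (intro set_sum_mono2) auto
  have "flag W (Suc d) = UNIV"
  proof -
    obtain B where B: "independent B" "span B = UNIV" "\<forall>b\<in>B. \<exists>\<theta>. A b = scale \<theta> b"
      using diag by (auto simp: diagonalizable_def)
    have "B \<subseteq> flag W (Suc d)"
    proof
      fix b assume b: "b \<in> B"
      then obtain \<theta> where \<theta>: "A b = scale \<theta> b" using B by auto
      have "b \<noteq> 0" using b B(1) dependent_zero by auto
      then have "{v. A v = scale \<theta> v} \<in> eigenspaces A"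
        using \<theta> by (auto simp: eigenspaces_def)
      then have "{v. A v = scale \<theta> v} \<in> W ` {0..d}"
        using std by (simp add: standard_ordering_def bij_betw_def)
      then obtain i where "i \<le> d" "W i = {v. A v = scale \<theta> v}" by force
      then show "b \<in> flag W (Suc d)" using W_le[of i "Suc d"] \<theta> by auto
    qed
    then show ?thesis using span_minimal[OF _ subG] B by blast
  qed
  moreover have "\<exists>\<theta>. \<forall>v\<in>flag W (Suc n). A v - scale \<theta> v \<in> flag W n" if n: "n \<le> d" for n
  proof -
    obtain \<theta> where \<theta>: "W n = {v. A v = scale \<theta> v}"
      using standard_ordering_eigenspace[OF std n] by metis
    have "A (v + w) - scale \<theta> (v + w) = (A v - scale \<theta> v) + (A w - scale \<theta> w)"
      "A (scale c v) - scale \<theta> (scale c v) = scale c (A v - scale \<theta> v)" for v w c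
      by (simp_all add: A.add A.scale scale_right_distrib scale_right_diff_distrib mult.commute)
    then have "subspace {v. A v - scale \<theta> v \<in> flag W n}"
      using subG[of n] n by (simp add: subspace_def A.zero)
    moreover have "W j \<subseteq> {v. A v - scale \<theta> v \<in> flag W n}" if j: "j < Suc n" for j
    proof (cases "j = n")
      case True
      then show ?thesis using \<theta> subspace_0[OF subG] n by auto
    next
      case False
      obtain \<eta> where \<eta>: "W j = {v. A v = scale \<eta> v}"
        using standard_ordering_eigenspace[OF std, of j] j n by auto
      have "A v - scale \<theta> v \<in> flag W n" if "v \<in> W j" for v
        using that \<eta> subspace_scale[OF subW, of j v "\<eta> - \<theta>"] W_le[of j n] False j n
        by (auto simp: scale_left_diff_distrib)
      then show ?thesis by auto
    qed
    ultimately have "flag W (Suc n) \<subseteq> {v. A v - scale \<theta> v \<in> flag W n}"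
      unfolding flag_def[of W "Suc n"] by (intro set_sum_least) auto
    then show ?thesis by auto
  qed
  moreover have "A' v \<in> flag W (Suc n)" if n: "n \<le> d" and v: "v \<in> flag W n" for n v
  proof -
    have "subspace {v. A' v \<in> flag W (Suc n)}"
      using subG[of "Suc n"] n unfolding subspace_def by (auto simp: A'.zero A'.add A'.scale)
    moreover have "W j \<subseteq> {v. A' v \<in> flag W (Suc n)}" if j: "j < n" for j
    proof -
      have "j \<le> d" using j n by simp
      then have "A' ` W j \<subseteq> (if j = 0 then {0} else W (j - 1)) + W j + (if j = d then {0} else W (j + 1))"
        using std unfolding standard_ordering_def by blast
      moreover have "(if j = 0 then {0} else W (j - 1)) \<subseteq> flag W (Suc n)"
        "W j \<subseteq> flag W (Suc n)" "(if j = d then {0} else W (j + 1)) \<subseteq> flag W (Suc n)"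
        using W_le[of "j - 1" "Suc n"] W_le[of j "Suc n"] W_le[of "j + 1" "Suc n"]
          subspace_0[OF subG, of "Suc n"] j n by auto
      ultimately have "A' ` W j \<subseteq> flag W (Suc n) + flag W (Suc n) + flag W (Suc n)"
        by (meson order_trans set_plus_mono2)
      also have "\<dots> \<subseteq> flag W (Suc n)"
        using subspace_add[OF subG, of "Suc n"] n by (auto elim!: set_plus_elim)
      finally show ?thesis by auto
    qed
    ultimately show ?thesis
      using v set_sum_least[of "{..<n}" "{v. A' v \<in> flag W (Suc n)}" W] by (auto simp: flag_def)
  qed
  moreover have "flag W 0 = {0}" by (simp add: flag_def set_zero)
  moreover have "flag W (Suc 0) \<noteq> {0}"
    using standard_ordering_eigenspace[OF std, of 0] by (auto simp: flag_def)
  ultimately show ?thesis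
    unfolding eigenflag_def using subG mono by blast
qed

text \<open>
  The pieces are parametrised by \<open>k\<close> along a diagonal. Modulo the scalar part, \<open>A\<close> raises \<open>X\<close> and lowers
  \<open>Y\<close>, so it moves the \<open>k\<close>th piece into the next one; \<open>A'\<close> moves it into the previous one. At
  the ends of the diagonal the image falls into \<open>X 0\<close> or \<open>Y 0\<close>, which are \<open>0\<close>; truncated subtraction
  in \<open>e - k\<close> merely adds zero pieces. The cases \<open>e = Suc d\<close> and \<open>e = d\<close> are the ones of interest.
\<close>

lemma diagonal_sum_invariant:
  assumes linA: "Vector_Spaces.linear scale scale A"
    and linA': "Vector_Spaces.linear scale scale A'"
    and Y: "eigenflag d A A' Y" and X: "eigenflag d A' A X"
    and S_def: "S = (\<Sum>k=0..d. X (Suc k) \<inter> Y (e - k))" and e: "e \<le> Suc d"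
  shows "subspace S" and "A ` S \<subseteq> S" and "A' ` S \<subseteq> S"
proof -
  interpret A: Vector_Spaces.linear scale scale A by fact
  interpret A': Vector_Spaces.linear scale scale A' by fact
  define T where "T k = X (Suc k) \<inter> Y (e - k)" for k
  have subT: "subspace (T k)" if "k \<le> d" for k
    unfolding T_def using X Y e that by (intro subspace_inter) (auto simp: eigenflag_subspace)
  have ST: "S = (\<Sum>k=0..d. T k)" by (simp add: S_def T_def)
  show subS: "subspace S" unfolding ST using subT by (intro subspace_set_sum) auto
  have T_le: "T k \<subseteq> S" if "k \<le> d" for k
    unfolding ST using subT that by (intro set_sum_upper) auto
  note S_add = subspace_add[OF subS] and S_scale = subspace_scale[OF subS]
    and S_0 = subspace_0[OF subS]
  have "A v \<in> S" if k: "k \<le> d" and v: "v \<in> T k" for k v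
  proof (cases "e - k")
    case 0
    then show ?thesis using v eigenflag_0[OF Y] S_0 by (simp add: T_def A.zero)
  next
    case (Suc m)
    have "m \<le> d" using Suc e by auto
    obtain \<theta> where \<theta>: "A v - scale \<theta> v \<in> Y m"
      using eigenflag_lower[OF Y \<open>m \<le> d\<close>] v Suc by (auto simp: T_def)
    have "A v - scale \<theta> v \<in> S"
    proof (cases "m = 0")
      case True
      then show ?thesis using \<theta> eigenflag_0[OF Y] S_0 by simp
    next
      case False
      then have k': "Suc k \<le> d" "e - Suc k = m" using Suc e by auto
      have X2: "subspace (X (Suc (Suc k)))" using eigenflag_subspace[OF X] k' by simp
      have "A v \<in> X (Suc (Suc k))" using eigenflag_raise[OF X] v k' by (simp add: T_def)
      moreover have "v \<in> X (Suc (Suc k))"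
        using eigenflag_mono[OF X, of "Suc k" "Suc (Suc k)"] v k' by (auto simp: T_def)
      ultimately have "A v - scale \<theta> v \<in> T (Suc k)"
        unfolding T_def using \<theta> k' subspace_diff[OF X2] subspace_scale[OF X2] by auto
      then show ?thesis using T_le k' by blast
    qed
    moreover have "scale \<theta> v \<in> S" using v T_le[OF k] S_scale by auto
    ultimately show ?thesis using S_add by fastforce
  qed
  then have "S \<subseteq> {v. A v \<in> S}"
    unfolding ST[THEN arg_cong[where f = "\<lambda>x. x \<subseteq> _"]]
    by (intro set_sum_least) (auto simp: subspace_def A.zero A.add A.scale S_0 S_add S_scale)
  then show "A ` S \<subseteq> S" by auto
  have "A' v \<in> S" if k: "k \<le> d" and v: "v \<in> T k" for k v
  proof -
    obtain \<theta> where \<theta>: "A' v - scale \<theta> v \<in> X k"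
      using eigenflag_lower[OF X k] v by (auto simp: T_def)
    have "A' v - scale \<theta> v \<in> S"
    proof (cases "k = 0 \<or> e - k = 0")
      case True
      then show ?thesis
      proof
        assume "k = 0"
        then show ?thesis using \<theta> eigenflag_0[OF X] S_0 by simp
      next
        assume "e - k = 0"
        then have "v = 0" using v eigenflag_0[OF Y] by (simp add: T_def)
        then show ?thesis using S_0 by (simp add: A'.zero)
      qed
    next
      case False
      then obtain k' where k': "k = Suc k'" "Suc (e - k) = e - k'" "e - k \<le> d"
        using e k by (cases k) auto
      have Y2: "subspace (Y (e - k'))" using eigenflag_subspace[OF Y] e by simp
      have "A' v \<in> Y (e - k')" using eigenflag_raise[OF Y k'(3), of v] v k'(2) by (simp add: T_def)
      moreover have "v \<in> Y (e - k')"
      proof -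
        have "Y (e - k) \<subseteq> Y (e - k')" using k' e by (intro eigenflag_mono[OF Y]) auto
        then show ?thesis using v by (auto simp: T_def)
      qed
      ultimately have "A' v - scale \<theta> v \<in> T k'"
        unfolding T_def using \<theta> k' subspace_diff[OF Y2] subspace_scale[OF Y2] by auto
      then show ?thesis using T_le[of k'] k' k by auto
    qed
    moreover have "scale \<theta> v \<in> S" using v T_le[OF k] S_scale by auto
    ultimately show ?thesis using S_add by fastforce
  qed
  then have "S \<subseteq> {v. A' v \<in> S}"
    unfolding ST[THEN arg_cong[where f = "\<lambda>x. x \<subseteq> _"]]
    by (intro set_sum_least) (auto simp: subspace_def A'.zero A'.add A'.scale S_0 S_add S_scale)
  then show "A' ` S \<subseteq> S" by auto
qed

text \<open>
  By irreducibility each diagonal sum is \<open>{0}\<close> or everything. The long diagonal \<open>e = Suc d\<close>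
  contains \<open>X (Suc 0) \<noteq> {0}\<close>, so the pieces span; the shorter one \<open>e = d\<close> lies in \<open>Y d \<noteq> UNIV\<close>, so its
  pieces, which are the intersections \<open>X i \<inter> Y (Suc d - i)\<close>, vanish. The \<open>min\<close> makes the flag
  constant beyond \<open>Suc d\<close>, as \<open>X\<close> is only known to be a flag up to there.
\<close>

lemma split_flags_of_irreducible:
  assumes linA: "Vector_Spaces.linear scale scale A"
    and linA': "Vector_Spaces.linear scale scale A'"
    and irred: "\<not> (\<exists>W. subspace W \<and> A ` W \<subseteq> W \<and> A' ` W \<subseteq> W \<and> W \<noteq> {0} \<and> W \<noteq> UNIV)"
    and Y: "eigenflag d A A' Y" and X: "eigenflag d A' A X"
    and proper: "Y d \<noteq> UNIV"
  shows "split_flags scale d (\<lambda>i. X (min i (Suc d))) (\<lambda>i. Y (Suc d - i))"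
proof -
  define S where "S e = (\<Sum>k=0..d. X (Suc k) \<inter> Y (e - k))" for e
  note inv = diagonal_sum_invariant[OF linA linA' Y X S_def]
  have sub: "subspace (X (Suc k) \<inter> Y (e - k))" if "k \<le> d" "e \<le> Suc d" for k e
    using X Y that by (intro subspace_inter) (auto simp: eigenflag_subspace)
  have T_le: "X (Suc k) \<inter> Y (e - k) \<subseteq> S e" if "k \<le> d" "e \<le> Suc d" for k e
    unfolding S_def using that sub by (intro set_sum_upper) auto
  have S_top: "S (Suc d) = UNIV"
  proof -
    have "X (Suc 0) \<subseteq> S (Suc d)" using T_le[of 0 "Suc d"] eigenflag_top[OF Y] by simp
    then have "S (Suc d) \<noteq> {0}"
      using eigenflag_1[OF X] subspace_0[OF eigenflag_subspace[OF X, of "Suc 0"]] by auto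
    then show ?thesis using irred inv[of "Suc d"] by blast
  qed
  have S_d: "S d = {0}"
  proof -
    have "S d \<subseteq> Y d"
      unfolding S_def
    proof (rule set_sum_least)
      show "subspace (Y d)" using eigenflag_subspace[OF Y] by simp
      fix k
      have "Y (d - k) \<subseteq> Y d" by (rule eigenflag_mono[OF Y]) auto
      then show "X (Suc k) \<inter> Y (d - k) \<subseteq> Y d" by auto
    qed simp
    then have "S d \<noteq> UNIV" using proper by auto
    then show ?thesis using irred inv[of d] by (metis le_SucI order_refl)
  qed
  show ?thesis
  proof
    show "subspace (X (min i (Suc d)))" for i by (simp add: eigenflag_subspace[OF X])
    show "subspace (Y (Suc d - i))" for i by (simp add: eigenflag_subspace[OF Y])
    show "X (min i (Suc d)) \<subseteq> X (min j (Suc d))" if "i \<le> j" for i j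
      using that by (intro eigenflag_mono[OF X]) auto
    show "Y (Suc d - j) \<subseteq> Y (Suc d - i)" if "i \<le> j" for i j
      using that by (intro eigenflag_mono[OF Y]) auto
    show "X (min 0 (Suc d)) = {0}" by (simp add: eigenflag_0[OF X])
    show "X (min (Suc d) (Suc d)) = UNIV" by (simp add: eigenflag_top[OF X])
    show "X (min i (Suc d)) \<inter> Y (Suc d - i) = {0}" if i: "i \<le> Suc d" for i
    proof (cases i)
      case 0
      then show ?thesis by (simp add: eigenflag_0[OF X] eigenflag_top[OF Y])
    next
      case (Suc k)
      then have "X (Suc k) \<inter> Y (d - k) \<subseteq> {0}" using T_le[of k d] S_d i by auto
      moreover have "0 \<in> X (Suc k) \<inter> Y (d - k)" using subspace_0[OF sub[of k d]] Suc i by auto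
      ultimately show ?thesis using Suc i by auto
    qed
    have "(\<Sum>i=0..d. X (min (Suc i) (Suc d)) \<inter> Y (Suc d - i)) = S (Suc d)"
      unfolding S_def by (rule sum.cong) auto
    then show "(\<Sum>i=0..d. X (min (Suc i) (Suc d)) \<inter> Y (Suc d - i)) = UNIV"
      using S_top by simp
  qed
qed

text \<open>
  The sum of all eigenspaces but one is a proper subspace because the primitive idempotent of the omitted
  eigenspace kills it. The permutation \<open>p\<close> covers both orderings of the eigenspaces.
\<close>

lemma flag_proper:
  assumes idem: "bij_betw E {0..d} (primitive_idempotents A)"
    and std: "standard_ordering d A A' (\<lambda>i. range (E i))"
    and p: "bij_betw p {0..d} {0..d}"
  shows "flag (\<lambda>i. range (E (p i))) d \<noteq> UNIV"
proof
  assume top: "flag (\<lambda>i. range (E (p i))) d = UNIV"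
  have pd: "p d \<le> d" using p by (auto simp: bij_betw_def)
  then have "E (p d) \<in> primitive_idempotents A" using idem by (auto simp: bij_betw_def)
  then obtain Z where lin: "Vector_Spaces.linear scale scale (E (p d))"
    and Z: "Z \<in> eigenspaces A" "range (E (p d)) = Z"
    and kill: "\<forall>Y\<in>eigenspaces A. Y \<noteq> Z \<longrightarrow> (\<forall>v\<in>Y. E (p d) v = 0)"
    unfolding primitive_idempotents_def mem_Collect_eq
    by (elim conjE bexE) (rule that; assumption)
  interpret P: Vector_Spaces.linear scale scale "E (p d)" by fact
  have "flag (\<lambda>i. range (E (p i))) d \<subseteq> {v. E (p d) v = 0}"
    unfolding flag_def
  proof (rule set_sum_least)
    show "subspace {v. E (p d) v = 0}" by (auto simp: subspace_def P.zero P.add P.scale)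
    fix j assume "j \<in> {..<d}"
    then have j: "j < d" by simp
    then have "p j \<le> d" "p j \<noteq> p d"
      using p by (auto simp: bij_betw_def dest: inj_onD)
    moreover have "bij_betw (\<lambda>i. range (E i)) {0..d} (eigenspaces A)"
      using std by (simp add: standard_ordering_def)
    ultimately have "range (E (p j)) \<in> eigenspaces A" "range (E (p j)) \<noteq> Z"
      using pd Z(2) inj_on_eq_iff[of "\<lambda>i. range (E i)" "{0..d}" "p j" "p d"]
      by (auto simp: bij_betw_def)
    then show "range (E (p j)) \<subseteq> {v. E (p d) v = 0}" using kill by blast
  qed simp
  then have "E (p d) v = 0" for v using top by auto
  then have "Z = {0}" by (auto simp: Z(2)[symmetric])
  then show False using Z(1) by (auto simp: eigenspaces_def)
qed

lemma split_flags_of_td_system: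
  assumes td: "td_system d A E A' E'"
    and p: "p = (\<lambda>i. i) \<or> p = (\<lambda>i. d - i)"
  shows "split_flags scale d (\<lambda>i. flag (\<lambda>j. range (E' j)) (min i (Suc d)))
    (\<lambda>i. flag (\<lambda>j. range (E (p j))) (Suc d - i))"
proof (rule split_flags_of_irreducible)
  have pair: "td_pair A A'" and stdA: "standard_ordering d A A' (\<lambda>i. range (E i))"
    and idem: "bij_betw E {0..d} (primitive_idempotents A)"
    and std': "standard_ordering d A' A (\<lambda>i. range (E' i))"
    using td by (auto simp: td_system_def)
  show lin: "Vector_Spaces.linear scale scale A" "Vector_Spaces.linear scale scale A'"
    and "\<not> (\<exists>W. subspace W \<and> A ` W \<subseteq> W \<and> A' ` W \<subseteq> W \<and> W \<noteq> {0} \<and> W \<noteq> UNIV)"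
    using pair by (simp_all add: td_pair_def)
  have diag: "diagonalizable A" "diagonalizable A'" using pair by (simp_all add: td_pair_def)
  have "standard_ordering d A A' (\<lambda>i. range (E (p i)))"
    using p stdA standard_ordering_reverse[OF stdA] by auto
  then show "eigenflag d A A' (flag (\<lambda>j. range (E (p j))))"
    by (rule eigenflag_of_standard_ordering[OF lin diag(1)])
  show "eigenflag d A' A (flag (\<lambda>j. range (E' j)))"
    by (rule eigenflag_of_standard_ordering[OF lin(2,1) diag(2) std'])
  have "bij_betw p {0..d} {0..d}"
    using p by (elim disjE) (auto intro: bij_betw_byWitness[of _ p])
  then show "flag (\<lambda>j. range (E (p j))) d \<noteq> UNIV"
    by (rule flag_proper[OF idem stdA])
qed

end

theorem lemma9p8:
  fixes scale :: "'k::field \<Rightarrow> 'v::ab_group_add \<Rightarrow> 'v"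
    and B :: "'v set"
    and d :: nat
    and A A' :: "'v \<Rightarrow> 'v"
    and E E' :: "nat \<Rightarrow> 'v \<Rightarrow> 'v"
  assumes "finite_dimensional_vector_space scale B"
    and "vector_space.dim scale (UNIV :: 'v set) > 0"
    and "vector_space.td_system scale d A E A' E'"
    and "d \<ge> 1"
  shows "\<forall>i\<le>d.
      (\<lambda>v. td_Delta d E E' v - v) ` range (E' i) \<subseteq> (\<Sum>j<i. range (E' j)) \<and>
      td_Delta d E E' ` (\<Sum>j=i..d. range (E j)) = (\<Sum>j=0..d - i. range (E j))"
proof -
  interpret finite_dimensional_vector_space scale B by fact
  let ?X = "\<lambda>i. flag (\<lambda>j. range (E' j)) (min i (Suc d))"
  let ?Q = "\<lambda>i. flag (\<lambda>j. range (E (d - j))) (Suc d - i)"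
  let ?Q' = "\<lambda>i. flag (\<lambda>j. range (E j)) (Suc d - i)"
  interpret S: two_split_flags scale d ?X ?Q ?Q'
    using split_flags_of_td_system[OF assms(3), of "\<lambda>i. d - i"]
      split_flags_of_td_system[OF assms(3), of "\<lambda>i. i"]
    by (simp add: two_split_flags_def)
  have X: "?X i = (\<Sum>j<i. range (E' j))" if "i \<le> Suc d" for i
    using that by (simp add: flag_def)
  have Q: "?Q i = (\<Sum>j=i..d. range (E j))" for i
    unfolding flag_def
    by (rule sum.reindex_bij_witness[of _ "\<lambda>j. d - j" "\<lambda>j. d - j"]) auto
  have Q': "?Q' i = (\<Sum>j=0..d - i. range (E j))" if "i \<le> d" for i
    unfolding flag_def using that by (intro sum.cong) auto
  have U: "S.up.U i = split_U d E E' i" "S.down.U i = split_U_Down d E E' i" if "i \<le> d" for i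
    unfolding S.up.U_def S.down.U_def split_U_def split_U_Down_def
    using that X[of "Suc i"] Q[of i] Q'[of i] by (simp_all add: lessThan_Suc_atMost atMost_atLeast0)
  have F: "S.up.F i = split_F d E E' i" "S.down.F i = split_F_Down d E E' i" if "i \<le> d" for i
    unfolding S.up.F_def S.down.F_def split_F_def split_F_Down_def
    using that U by (auto intro!: arg_cong2[where f = projection_along] sum.cong)
  have Delta: "td_Delta d E E' = S.\<Delta>"
    using F by (intro ext) (auto simp: td_Delta_def S.\<Delta>_def intro!: sum.cong)
  show ?thesis
  proof (intro allI impI conjI)
    fix i assume i: "i \<le> d"
    have "range (E' i) \<subseteq> ?X (Suc i)"
      unfolding flag_def
    proof (rule set_sum_upper)
      fix j assume "j \<in> {..<min (Suc i) (Suc d)}"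
      then have "j \<le> d" by simp
      then obtain \<theta> where "range (E' j) = {v. A' v = scale \<theta> v}"
        using standard_ordering_eigenspace[of d A' A "\<lambda>i. range (E' i)" j] assms(3)
        unfolding td_system_def by metis
      then show "subspace (range (E' j))"
        using subspace_eigenspace[of A'] assms(3) by (simp add: td_system_def td_pair_def)
    qed (use i in auto)
    then show "(\<lambda>v. td_Delta d E E' v - v) ` range (E' i) \<subseteq> (\<Sum>j<i. range (E' j))"
      using S.Delta_unipotent[of _ i] X[of i] i unfolding Delta by auto
    show "td_Delta d E E' ` (\<Sum>j=i..d. range (E j)) = (\<Sum>j=0..d - i. range (E j))"
      using S.Delta_image_Q[of i] Q[of i] Q'[of i] i unfolding Delta by simp
  qed
qed

end
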